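(* Any deterministic streaming algorithm that verifies whether an integer array of length $n$ is a valid $\pi$ array (border array), or whether it is a valid $\pi'$ array (strict border array), requires $\Omega(n)$ bits of memory.
   Context: For a word $w$ of length $n$, $\pi_w[i]$ is the length of the longest proper border (a word that is both a proper prefix and a proper suffix) of $w[1\dots i]$. The strict border array $\pi'_w$ is defined by $\pi'_w[n]=\pi_w[n]$ and, for $i<n$, $\pi'_w[i]$ is the length of the longest proper border $u$ of $w[1\dots i]$ with $w[|u|+1]\neq w[i+1]$, or $-1$ if none exists. An array is a valid $\pi$ (resp. $\pi'$) array if it equals $\pi_w$ (resp. $\pi'_w$) for some word $w$ over some alphabet. In the streaming setting, the input values are given one by one and cannot be re-read. *)

theory Defs
  imports Complex_Main "HOL-Library.Sublist" "HOL-Library.Landau_Symbols"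
begin

definition proper_border :: "'a list \<Rightarrow> 'a list \<Rightarrow> bool" where
  "proper_border u v \<longleftrightarrow> strict_prefix u v \<and> strict_suffix u v"

text \<open>
  Positions \<open>i\<close> are numbered from 1 as in \<open>w[1..n]\<close>, so \<open>take i w\<close> is \<open>w[1..i]\<close>, while
  \<open>w ! i\<close> is the letter \<open>w[i+1]\<close>.  The empty word is a proper border of every nonempty word.
\<close>

definition border_at :: "'a list \<Rightarrow> nat \<Rightarrow> int" where
  "border_at w i = int (Max (length ` {u. proper_border u (take i w)}))"

definition strict_border_at :: "'a list \<Rightarrow> nat \<Rightarrow> int" where
  "strict_border_at w i =
     (if i = length w then border_at w i
      else let B = {u. proper_border u (take i w) \<and> w ! length u \<noteq> w ! i}
           in if B = {} then -1 else int (Max (length ` B)))"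

definition border_array :: "'a list \<Rightarrow> int list" where
  "border_array w = map (border_at w) [1..<length w + 1]"

definition strict_border_array :: "'a list \<Rightarrow> int list" where
  "strict_border_array w = map (strict_border_at w) [1..<length w + 1]"

text \<open>
  A finite word over any alphabet can be relettered injectively by natural numbers without changing
  its arrays, so words over \<open>nat\<close> cover all alphabets; this is
  \<open>valid_border_array_of_word\<close> and \<open>valid_strict_border_array_of_word\<close> below.
\<close>

definition valid_border_array :: "int list \<Rightarrow> bool" where
  "valid_border_array xs \<longleftrightarrow> (\<exists>w :: nat list. border_array w = xs)"

definition valid_strict_border_array :: "int list \<Rightarrow> bool" where
  "valid_strict_border_array xs \<longleftrightarrow> (\<exists>w :: nat list. strict_border_array w = xs)"

lemma proper_border_map:
  assumes inj: "inj_on f (set v)"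
  shows "{u. proper_border u (map f v) \<and> P (length u)}
       = map f ` {u. proper_border u v \<and> P (length u)}"
proof -
  have eq: "map f x = map f y \<longleftrightarrow> x = y" if "set x \<subseteq> set v" "set y \<subseteq> set v" for x y
    using inj that by (meson inj_on_map_eq_map inj_on_subset le_sup_iff)
  have "proper_border (map f u) (map f v)" if "proper_border u v" for u
  proof -
    from that have "set u \<subseteq> set v"
      unfolding proper_border_def strict_prefix_def by (auto dest: set_mono_prefix)
    with that show ?thesis
      unfolding proper_border_def strict_prefix_def strict_suffix_def
      by (auto simp: eq map_mono_prefix map_mono_suffix)
  qed
  moreover have "\<exists>u'. u = map f u' \<and> proper_border u' v" if "proper_border u (map f v)" for u
  proof -
    from that obtain zs ys where pre: "map f v = u @ zs" and suf: "map f v = ys @ u"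
      and ne: "u \<noteq> map f v"
      unfolding proper_border_def strict_prefix_def strict_suffix_def prefix_def suffix_def by blast
    from pre obtain u' zs' where u': "v = u' @ zs'" "u = map f u'"
      unfolding map_eq_append_conv by blast
    from suf obtain ys' u'' where u'': "v = ys' @ u''" "u = map f u''"
      unfolding map_eq_append_conv by blast
    have "set u' \<subseteq> set v" using u'(1) by simp
    moreover have "set u'' \<subseteq> set v" using u''(1) by simp
    ultimately have "u' = u''" using eq u'(2) u''(2) by metis
    then show ?thesis
      using ne u' u'' unfolding proper_border_def strict_prefix_def strict_suffix_def
      by (metis prefixI suffixI)
  qed
  ultimately show ?thesis by fastforce
qed

lemma border_at_map:
  assumes "inj_on f (set w)"
  shows "border_at (map f w) i = border_at w i"
proof -
  have "inj_on f (set (take i w))"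
    using assms by (meson inj_on_subset set_take_subset)
  from proper_border_map[OF this, of "\<lambda>_. True"]
  show ?thesis by (simp add: border_at_def take_map image_image)
qed

lemma strict_border_at_map:
  assumes inj: "inj_on f (set w)" and "i \<le> length w"
  shows "strict_border_at (map f w) i = strict_border_at w i"
proof (cases "i = length w")
  case True
  then show ?thesis by (simp add: strict_border_at_def border_at_map[OF inj])
next
  case False
  with assms(2) have i: "i < length w" by simp
  have inj': "inj_on f (set (take i w))"
    using inj by (meson inj_on_subset set_take_subset)
  have len: "length u < i" if "proper_border u v" "length v = i" for u and v :: "'c list"
    using that prefix_length_less[of u v] by (auto simp: proper_border_def)
  have "{u. proper_border u (take i (map f w)) \<and> map f w ! length u \<noteq> map f w ! i}
      = {u. proper_border u (map f (take i w)) \<and> f (w ! length u) \<noteq> f (w ! i)}"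
    using i by (auto simp: take_map dest: len)
  also have "\<dots> = map f ` {u. proper_border u (take i w) \<and> f (w ! length u) \<noteq> f (w ! i)}"
    by (rule proper_border_map[OF inj'])
  also have "{u. proper_border u (take i w) \<and> f (w ! length u) \<noteq> f (w ! i)}
      = {u. proper_border u (take i w) \<and> w ! length u \<noteq> w ! i}"
    using i inj len[of _ "take i w"] by (fastforce simp: inj_on_eq_iff)
  finally show ?thesis
    using False by (simp add: strict_border_at_def Let_def image_image)
qed

lemma valid_border_array_of_word: "valid_border_array (border_array w)"
proof -
  obtain f :: "'a \<Rightarrow> nat" where f: "inj_on f (set w)"
    using finite_imp_inj_to_nat_seg[OF finite_set[of w]] by blast
  have "border_array (map f w) = border_array w"
    by (simp add: border_array_def border_at_map[OF f])
  then show ?thesis unfolding valid_border_array_def by blast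
qed

lemma valid_strict_border_array_of_word: "valid_strict_border_array (strict_border_array w)"
proof -
  obtain f :: "'a \<Rightarrow> nat" where f: "inj_on f (set w)"
    using finite_imp_inj_to_nat_seg[OF finite_set[of w]] by blast
  have "strict_border_array (map f w) = strict_border_array w"
    by (auto simp: strict_border_array_def strict_border_at_map[OF f] simp del: upt_Suc)
  then show ?thesis unfolding valid_strict_border_array_def by blast
qed

text \<open>
  The memory contents between two input values are a bit string; the next contents depend only on
  the current contents and the value being read.  Neither the computation inside a step nor the
  read-only code is charged, and the verdict is only asked for after the last value.
\<close>

record streaming_algorithm =
  init :: "bool list"
  step :: "bool list \<Rightarrow> int \<Rightarrow> bool list"
  accept :: "bool list \<Rightarrow> bool"

definition run :: "streaming_algorithm \<Rightarrow> int list \<Rightarrow> bool list" where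
  "run A xs = foldl (step A) (init A) xs"

definition verifies :: "streaming_algorithm \<Rightarrow> nat \<Rightarrow> (int list \<Rightarrow> bool) \<Rightarrow> bool" where
  "verifies A n P \<longleftrightarrow> (\<forall>xs. length xs = n \<longrightarrow> (accept A (run A xs) \<longleftrightarrow> P xs))"

definition memory_bounded :: "streaming_algorithm \<Rightarrow> nat \<Rightarrow> nat \<Rightarrow> bool" where
  "memory_bounded A n b \<longleftrightarrow> (\<forall>xs. length xs \<le> n \<longrightarrow> length (run A xs) \<le> b)"

text \<open>
  The algorithm may depend on the input length \<open>n\<close>; an algorithm that does not know \<open>n\<close> is a
  constant family \<open>A\<close>.
\<close>

definition requires_linear_memory :: "(int list \<Rightarrow> bool) \<Rightarrow> bool" where
  "requires_linear_memory P \<longleftrightarrow>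
     (\<forall>A b. (\<forall>n. verifies (A n) n P \<and> memory_bounded (A n) n (b n))
        \<longrightarrow> (\<lambda>n. real (b n)) \<in> \<Omega>(\<lambda>n. real n))"

end

theory Submission
  imports Defs
begin

text \<open>
  Both bounds come from a fooling set of \<open>2 ^ k\<close> prefixes with \<open>k\<close> linear in \<open>n\<close>, which must lead
  to distinct memory contents.  The words \<open>0 1 z\<^sub>1 \<dots> z\<^sub>k\<close> with every \<open>z\<^sub>i\<close> either \<open>0\<close> or a fresh
  letter have the border arrays \<open>0, 0, x\<^sub>1, \<dots>, x\<^sub>k\<close> for all bit strings \<open>x\<close>.

  For \<open>\<pi>\<close>, a suffix \<open>0, 1, \<dots>, j, 1\<close> forces a copy of the first \<open>j\<close> letters followed by the letter
  \<open>0\<close>, but without extending the copy; so it reveals whether letter \<open>j + 1\<close> is \<open>0\<close>.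

  For \<open>\<pi>'\<close>, the words are followed by fresh letters and then repeated.  Since
  \<open>\<pi>[i] = max (\<pi>'[i]) (\<pi>[i + 1] - 1)\<close> and \<open>\<pi>'[n] = \<pi>[n]\<close>, the suffix of a strict border array
  determines the corresponding suffix of the border array, hence the fact that it describes a
  repetition; and inside the repetition \<open>\<pi>'\<close> repeats its own beginning.  So no prefix can be completed
  by the suffix belonging to another word.
\<close>

section \<open>Counting memory states\<close>

text \<open>Two prefixes that reach the same memory contents receive the same verdict under every
  common continuation. Hence \<open>run A \<circ> f\<close> is injective on \<open>S\<close>, while
  there are only \<open>2 ^ Suc b - 1\<close> bit strings of length at most
  \<open>b\<close>.\<close>

lemma fooling_set_bound:
  fixes f :: "'a \<Rightarrow> int list"
  assumes ver: "verifies A n P" and mem: "memory_bounded A n b"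
    and len: "\<And>x. x \<in> S \<Longrightarrow> length (f x) \<le> n"
    and sep: "\<And>x y. x \<in> S \<Longrightarrow> y \<in> S \<Longrightarrow> x \<noteq> y \<Longrightarrow>
      \<exists>z. length (f x @ z) = n \<and> length (f y @ z) = n \<and> P (f x @ z) \<noteq> P (f y @ z)"
  shows "card S < 2 ^ Suc b"
proof -
  let ?M = "{ys :: bool list. set ys \<subseteq> UNIV \<and> length ys \<le> b}"
  have "inj_on (run A \<circ> f) S"
  proof (rule inj_onI, rule ccontr)
    fix x y assume x: "x \<in> S" and y: "y \<in> S" and eq: "(run A \<circ> f) x = (run A \<circ> f) y" and "x \<noteq> y"
    then obtain z where z: "length (f x @ z) = n" "length (f y @ z) = n" "P (f x @ z) \<noteq> P (f y @ z)"
      using sep by blast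
    have "run A (f x @ z) = run A (f y @ z)"
      using eq by (simp add: run_def)
    with z ver show False by (metis verifies_def)
  qed
  moreover have "(run A \<circ> f) ` S \<subseteq> ?M"
    using mem len by (auto simp: memory_bounded_def)
  moreover have "finite ?M" by (rule finite_lists_length_le) simp
  ultimately have "card S \<le> card ?M" by (rule card_inj_on_le)
  also have "\<dots> = (\<Sum>i\<le>b. 2 ^ i)"
    by (subst card_lists_length_le) (simp_all add: card_UNIV_bool)
  also have "\<dots> < 2 ^ Suc b"
    by (induction b) auto
  finally show ?thesis .
qed

text \<open>The room \<open>2 * k + 6\<close> suits both constructions: \<open>k + 2\<close> entries
  and a query of fewer than \<open>k + 4\<close> entries for \<pi>, and a block of at least
  \<open>k + 3\<close> entries followed by one of exactly \<open>k + 3\<close> for \<pi>'.\<close>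

lemma requires_linear_memoryI:
  assumes "\<And>n k. n \<ge> 2 * k + 6 \<Longrightarrow> \<exists>f. \<forall>x y. length x = k \<longrightarrow> length y = k \<longrightarrow>
      length (f x) \<le> n \<and> (x \<noteq> y \<longrightarrow>
        (\<exists>z. length (f x @ z) = n \<and> length (f y @ z) = n \<and> P (f x @ z) \<noteq> P (f (y :: bool list) @ z)))"
  shows "requires_linear_memory P"
  unfolding requires_linear_memory_def
proof (intro allI impI)
  fix A :: "nat \<Rightarrow> streaming_algorithm" and b
  assume A: "\<forall>n. verifies (A n) n P \<and> memory_bounded (A n) n (b n)"
  have bound: "(n - 6) div 2 \<le> b n" if "n \<ge> 6" for n
  proof -
    define k where "k = (n - 6) div 2"
    have "n \<ge> 2 * k + 6" using that by (simp add: k_def)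
    from assms[OF this] obtain f where f: "\<And>x y. length x = k \<Longrightarrow> length y = k \<Longrightarrow>
      length (f x) \<le> n \<and> (x \<noteq> y \<longrightarrow>
        (\<exists>z. length (f x @ z) = n \<and> length (f y @ z) = n \<and> P (f x @ z) \<noteq> P (f (y :: bool list) @ z)))"
      by metis
    have "card {x :: bool list. set x \<subseteq> UNIV \<and> length x = k} < 2 ^ Suc (b n)"
      by (rule fooling_set_bound[where A = "A n" and n = n and P = P and f = f]) (use A f in auto)
    then have "(2 :: nat) ^ k < 2 ^ Suc (b n)"
      by (subst (asm) card_lists_length_eq) (simp_all add: card_UNIV_bool)
    then have "k < Suc (b n)" by (rule power_less_imp_less_exp[rotated]) simp
    then show ?thesis by (simp add: k_def)
  qed
  show "(\<lambda>n. real (b n)) \<in> \<Omega>(\<lambda>n. real n)"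
  \<comment> \<open>The bound gives \<open>n \<le> 2 * b n + 7\<close>; for large \<open>n\<close>
    the 7 is at most \<open>n / 2\<close>, whence the constant \<open>1/4\<close>.\<close>
  proof (rule landau_omega.bigI[of "1/4"])
    show "\<forall>\<^sub>F n in sequentially. norm (real (b n)) \<ge> 1/4 * norm (real n)"
      using eventually_ge_at_top[of 20]
    proof eventually_elim
      case (elim n)
      then have "n \<le> 4 * b n" using bound[of n] by linarith
      then show ?case by simp
    qed
  qed simp
qed

section \<open>Borders\<close>

text \<open>A border of a given prefix is determined by its length. For
  \<open>i \<le> length w\<close>, \<open>r\<close> stands for the border of \<open>take i w\<close>
  of that length, and the letter following its occurrence at the front is
  \<open>w ! r\<close>.\<close>

definition border_len :: "'a list \<Rightarrow> nat \<Rightarrow> nat \<Rightarrow> bool" where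
  "border_len w i r \<longleftrightarrow> r < i \<and> (\<forall>j<r. w ! j = w ! (i - r + j))"

lemma border_len_0 [simp]: "border_len w i 0 \<longleftrightarrow> 0 < i"
  by (simp add: border_len_def)

lemma border_len_less: "border_len w i r \<Longrightarrow> r < i"
  by (simp add: border_len_def)

lemma border_len_nth: "border_len w i r \<Longrightarrow> j < r \<Longrightarrow> w ! (i - r + j) = w ! j"
  by (simp add: border_len_def)

lemma finite_border_len [simp]: "finite {r. border_len w i r \<and> Q r}"
  by (rule finite_subset[of _ "{..<i}"]) (auto simp: border_len_def)

text \<open>The recurrence behind the Knuth-Morris-Pratt prefix function.\<close>

lemma border_len_Suc_Suc [simp]:
  "border_len w (Suc i) (Suc r) \<longleftrightarrow> border_len w i r \<and> w ! r = w ! i"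
  by (auto simp: border_len_def less_Suc_eq)

lemma border_len_append: "i \<le> length w \<Longrightarrow> border_len (w @ v) i r \<longleftrightarrow> border_len w i r"
  by (auto simp: border_len_def nth_append)

text \<open>As \<open>take t w\<close> is also a suffix of \<open>take i w\<close>, both words have
  the same suffixes of length below \<open>t\<close>.\<close>

lemma border_len_shorter:
  assumes "border_len w i t" "r < t"
  shows "border_len w i r \<longleftrightarrow> border_len w t r"
proof -
  have "w ! (i - r + j) = w ! (t - r + j)" if "j < r" for j
    using border_len_nth[OF assms(1), of "t - r + j"] assms border_len_less[OF assms(1)] that
    by (simp add: algebra_simps)
  with assms show ?thesis by (auto simp: border_len_def)
qed

text \<open>Passes from border words to their lengths. \<open>Q\<close> is trivial for \<pi> and
  expresses the mismatch of the next letters for \<pi>'.\<close>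

lemma proper_border_length:
  assumes "i \<le> length w"
  shows "length ` {u. proper_border u (take i w) \<and> Q (length u)} = {r. border_len w i r \<and> Q r}"
    (is "length ` ?L = ?R")
proof (intro equalityI subsetI)
  fix r assume "r \<in> length ` ?L"
  then obtain u where u: "proper_border u (take i w)" "Q (length u)" "r = length u" by blast
  then obtain ys zs where z: "take i w = u @ zs" "take i w = ys @ u" "u \<noteq> take i w"
    unfolding proper_border_def strict_prefix_def strict_suffix_def prefix_def suffix_def by blast
  have li: "length u + length zs = i" "length ys + length u = i"
    using z(1,2) assms by (metis length_append length_take min.absorb2)+
  have "zs \<noteq> []" using z by auto
  then have "r < i" using li u(3) by (cases zs) auto
  moreover have "w ! j = w ! (i - r + j)" if "j < r" for j
  proof -
    have "w ! j = take i w ! j" using that \<open>r < i\<close> by simp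
    also have "\<dots> = u ! j" using that u(3) by (simp add: z(1) nth_append)
    also have "\<dots> = take i w ! (length ys + j)" by (simp add: z(2))
    also have "\<dots> = w ! (i - r + j)" using that li u(3) by auto
    finally show ?thesis .
  qed
  ultimately show "r \<in> ?R" using u by (simp add: border_len_def)
next
  fix r assume "r \<in> ?R"
  then have r: "r < i" "\<forall>j<r. w ! j = w ! (i - r + j)" "Q r" by (auto simp: border_len_def)
  have "take r w = drop (i - r) (take i w)"
    by (rule nth_equalityI) (use r assms in auto)
  moreover have "take r w = take r (take i w)" using r by simp
  ultimately have "proper_border (take r w) (take i w)"
    using r assms unfolding proper_border_def strict_prefix_def strict_suffix_def
    by (metis suffix_drop take_is_prefix length_take less_irrefl_nat min.absorb2 order.strict_trans2 order_less_imp_le)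
  then show "r \<in> length ` ?L" using r assms by (intro image_eqI[of _ _ "take r w"]) auto
qed

lemma border_at_Max: "i \<le> length w \<Longrightarrow> border_at w i = int (Max {r. border_len w i r})"
  using proper_border_length[of i w "\<lambda>_. True"] by (simp add: border_at_def)

lemma strict_border_at_Max:
  assumes "i < length w"
  shows "strict_border_at w i = (let B = {r. border_len w i r \<and> w ! r \<noteq> w ! i}
    in if B = {} then -1 else int (Max B))"
  using proper_border_length[of i w "\<lambda>r. w ! r \<noteq> w ! i"] assms
  by (simp add: strict_border_at_def Let_def del: Collect_empty_eq)
    (metis (no_types, lifting) image_is_empty)

section \<open>The longest border and its change under one more letter\<close>

lemma border_atE:
  assumes "0 < i" "i \<le> length w"
  obtains r where "border_at w i = int r" "border_len w i r" "\<And>q. border_len w i q \<Longrightarrow> q \<le> r"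
proof -
  let ?B = "{r. border_len w i r}"
  have fin: "finite ?B" using finite_border_len[of w i "\<lambda>_. True"] by simp
  have "0 \<in> ?B" using assms by simp
  then have "Max ?B \<in> ?B" using fin by (metis Max_in empty_iff)
  then show ?thesis
    using that[of "Max ?B"] border_at_Max[OF assms(2)] fin by simp
qed

lemma border_len_le_border_at:
  "i \<le> length w \<Longrightarrow> border_len w i r \<Longrightarrow> int r \<le> border_at w i"
  using border_len_less[of w i r] by (elim border_atE[rotated]) auto

lemma border_at_nonneg: "0 < i \<Longrightarrow> i \<le> length w \<Longrightarrow> 0 \<le> border_at w i"
  by (elim border_atE) auto

lemma border_len_border_at:
  assumes "0 < i" "i \<le> length w" "border_at w i = int r"
  shows "border_len w i r"
  using assms by (elim border_atE) auto

lemma border_at_le_1E: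
  assumes "border_len w i r" "0 < r" "i \<le> length w" "border_at w i \<le> 1"
  shows "r = 1"
  using border_len_le_border_at[OF assms(3,1)] assms by linarith

text \<open>Deleting the last letter of a nonempty border leaves a border of the preceding
  prefix.\<close>

lemma border_at_Suc_le:
  assumes "0 < i" "i < length w"
  shows "border_at w (Suc i) \<le> border_at w i + 1"
proof -
  obtain r where r: "border_at w (Suc i) = int r" "border_len w (Suc i) r"
    using border_atE[of "Suc i" w] assms by (metis Suc_leI zero_less_Suc)
  show ?thesis
  proof (cases r)
    case 0
    then show ?thesis using r border_at_nonneg[of i w] assms by simp
  next
    case (Suc q)
    then show ?thesis using r border_len_le_border_at[of i w q] assms by simp
  qed
qed

text \<open>The last letter of a nonempty proper border occurs at an earlier position too.\<close>

lemma border_at_Suc_fresh: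
  assumes "i < length w" "\<And>j. j < i \<Longrightarrow> w ! j \<noteq> w ! i"
  shows "border_at w (Suc i) = 0"
proof -
  obtain r where r: "border_at w (Suc i) = int r" "border_len w (Suc i) r"
    using border_atE[of "Suc i" w] assms by (metis Suc_leI zero_less_Suc)
  then show ?thesis using assms(2) border_len_less[OF r(2)] by (cases r) auto
qed

text \<open>The new letter alone is a border. A longer one would extend a nonempty border whose next
  letter is \<open>w ! 0\<close>.\<close>

lemma border_at_Suc_eq_1:
  assumes "0 < i" "i < length w" "w ! i = w ! 0"
    and "\<And>r. border_len w i r \<Longrightarrow> 0 < r \<Longrightarrow> w ! r \<noteq> w ! 0"
  shows "border_at w (Suc i) = 1"
proof -
  obtain r where r: "border_at w (Suc i) = int r" "border_len w (Suc i) r"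
      and max: "\<And>q. border_len w (Suc i) q \<Longrightarrow> q \<le> r"
    using border_atE[of "Suc i" w] assms(2) by (metis Suc_leI zero_less_Suc)
  have "1 \<le> r" using assms by (intro max) simp
  then obtain q where q: "r = Suc q" by (cases r) auto
  with r have "border_len w i q" "w ! q = w ! 0" using assms(3) by auto
  with assms(4) have "q = 0" by blast
  with r q show ?thesis by simp
qed

text \<open>The copied letters form a border of length \<open>t\<close>. None is longer, since the
  value starts at 0 and grows by at most one per letter.\<close>

lemma border_at_repeat:
  assumes "border_at w s = 0" "0 < s" "s + t \<le> length w" "\<And>j. j < t \<Longrightarrow> w ! (s + j) = w ! j"
  shows "border_at w (s + t) = int t"
  using assms(3,4)
proof (induction t)
  case 0
  then show ?case using assms by simp
next
  case (Suc t)
  have "border_len w (s + Suc t) (Suc t)"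
    using Suc.prems assms(2) by (auto simp: border_len_def simp del: border_len_Suc_Suc)
  then have "int (Suc t) \<le> border_at w (s + Suc t)"
    using Suc.prems by (intro border_len_le_border_at) auto
  moreover have "border_at w (s + t) = int t" using Suc by auto
  ultimately show ?case
    using border_at_Suc_le[of "s + t" w] Suc.prems assms(2) by simp
qed

section \<open>Border arrays of extended words\<close>

lemma border_at_append: "i \<le> length w \<Longrightarrow> border_at (w @ v) i = border_at w i"
  by (simp add: border_at_def)

lemma length_border_array [simp]: "length (border_array w) = length w"
  by (simp add: border_array_def del: upt_Suc)

lemma length_strict_border_array [simp]: "length (strict_border_array w) = length w"
  by (simp add: strict_border_array_def del: upt_Suc)

lemma nth_border_array: "i < length w \<Longrightarrow> border_array w ! i = border_at w (Suc i)"
  by (simp add: border_array_def del: upt_Suc)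

lemma nth_strict_border_array: "i < length w \<Longrightarrow> strict_border_array w ! i = strict_border_at w (Suc i)"
  by (simp add: strict_border_array_def del: upt_Suc)

lemma border_array_snoc:
  "border_array (w @ [c]) = border_array w @ [border_at (w @ [c]) (Suc (length w))]"
  by (auto simp: border_array_def border_at_append)

lemma border_array_append_fresh:
  assumes "distinct c" "set c \<inter> set w = {}"
  shows "border_array (w @ c) = border_array w @ replicate (length c) 0"
  using assms
proof (induction c rule: rev_induct)
  case (snoc a c)
  have "border_at ((w @ c) @ [a]) (Suc (length (w @ c))) = 0"
    using snoc.prems by (intro border_at_Suc_fresh) (auto simp: nth_append dest: nth_mem)
  with snoc border_array_snoc[of "w @ c" a] show ?case
    by (simp add: replicate_append_same)
qed simp

text \<open>The fresh letter \<open>c\<close> resets the border length to 0, after which each copied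
  letter raises it by one.\<close>

lemma border_array_append_copy:
  assumes "c \<notin> set w" "j \<le> length w"
  shows "border_array (w @ c # take j w) = border_array w @ map int [0..<Suc j]"
proof (rule nth_equalityI)
  show "length (border_array (w @ c # take j w)) = length (border_array w @ map int [0..<Suc j])"
    using assms by simp
  fix i assume i: "i < length (border_array (w @ c # take j w))"
  let ?v = "w @ c # take j w"
  show "border_array ?v ! i = (border_array w @ map int [0..<Suc j]) ! i"
  proof (cases "i < length w")
    case True
    then show ?thesis using i by (simp add: nth_border_array nth_append border_at_append)
  next
    case False
    then obtain t where t: "i = length w + t" using le_Suc_ex not_less by blast
    have "border_at ?v (Suc (length w)) = 0"
      using assms by (intro border_at_Suc_fresh) (auto simp: nth_append)
    then have "border_at ?v (Suc (length w) + t) = int t"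
      using i t assms by (intro border_at_repeat) (auto simp: nth_append)
    then show ?thesis using i t by (simp add: nth_border_array nth_append del: upt_Suc)
  qed
qed

section \<open>Strict borders\<close>

lemma strict_border_at_le:
  assumes "0 < i" "i \<le> length w"
  shows "strict_border_at w i \<le> border_at w i"
proof (cases "i = length w")
  case True
  then show ?thesis by (simp add: strict_border_at_def)
next
  case False
  let ?B = "{r. border_len w i r \<and> w ! r \<noteq> w ! i}"
  have "int (Max ?B) \<le> border_at w i" if "?B \<noteq> {}"
    using Max_in[OF finite_border_len that] assms by (intro border_len_le_border_at) auto
  then show ?thesis
    using False assms border_at_nonneg[OF assms] by (auto simp: strict_border_at_Max Let_def)
qed

lemma border_len_le_strict_border_at:
  assumes "i < length w" "border_len w i r" "w ! r \<noteq> w ! i"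
  shows "int r \<le> strict_border_at w i"
proof -
  have "r \<in> {r. border_len w i r \<and> w ! r \<noteq> w ! i}" using assms by simp
  then show ?thesis using assms(1) Max_ge[OF finite_border_len]
    by (auto simp: strict_border_at_Max Let_def)
qed

text \<open>The next letters after the longest border either differ, so that this border is strict,
  or agree, so that it extends to a border of the next prefix.\<close>

lemma border_at_conv_strict:
  assumes "0 < i" "i < length w"
  shows "border_at w i = max (strict_border_at w i) (border_at w (Suc i) - 1)"
proof (rule antisym)
  obtain r where r: "border_at w i = int r" "border_len w i r"
    using assms by (elim border_atE[of i]) auto
  show "border_at w i \<le> max (strict_border_at w i) (border_at w (Suc i) - 1)"
  proof (cases "w ! r = w ! i")
    case True
    then have "int (Suc r) \<le> border_at w (Suc i)"
      using r assms by (intro border_len_le_border_at) auto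
    then show ?thesis using r by simp
  next
    case False
    then show ?thesis using border_len_le_strict_border_at r assms by fastforce
  qed
  show "max (strict_border_at w i) (border_at w (Suc i) - 1) \<le> border_at w i"
    using strict_border_at_le[of i w] border_at_Suc_le[of i w] assms by simp
qed

text \<open>Descending from \<open>q\<close>, the maximum formula computes each \<pi> value from the
  \<pi>' value there and the \<pi> value after it.\<close>

lemma border_at_cong_strict:
  assumes "i \<le> q" "0 < i" "q \<le> length w" "q \<le> length v" "border_at w q = border_at v q"
    and "\<And>j. i \<le> j \<Longrightarrow> j < q \<Longrightarrow> strict_border_at w j = strict_border_at v j"
  shows "border_at w i = border_at v i"
  using assms(1,2,6)
proof (induction i rule: inc_induct)
  case base
  then show ?case using assms(5) by simp
next
  case (step i)
  then have "border_at w (Suc i) = border_at v (Suc i)" by auto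
  with step show ?case using assms(3,4) by (simp add: border_at_conv_strict)
qed

text \<open>The longest border \<open>t\<close> extends, so it is not strict, and all strict borders
  at \<open>i\<close> are shorter. They are borders of \<open>take t w\<close>, and the letters to
  be avoided agree because \<open>w ! t = w ! i\<close>.\<close>

lemma strict_border_at_eq:
  assumes "0 < t" "i < length w" "border_at w i = int t" "border_at w (Suc i) = int (Suc t)"
  shows "strict_border_at w i = strict_border_at w t"
proof -
  have "border_len w (Suc i) (Suc t)"
    using assms by (intro border_len_border_at) auto
  then have b: "border_len w i t" "w ! t = w ! i" by auto
  have "r < t" if "border_len w i r" "w ! r \<noteq> w ! i" for r
  proof -
    have "int r \<le> int t" using border_len_le_border_at[of i w r] that assms by simp
    then show ?thesis using that b(2) by (cases "r = t") auto
  qed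
  then have "{r. border_len w i r \<and> w ! r \<noteq> w ! i} = {r. border_len w t r \<and> w ! r \<noteq> w ! t}"
    using border_len_shorter[OF b(1)] b(2) border_len_less by (metis (no_types, opaque_lifting))
  moreover have "t < length w" using border_len_less[OF b(1)] assms by simp
  ultimately show ?thesis using assms by (simp add: strict_border_at_Max)
qed

text \<open>A word \<open>w\<close> realizing the spliced array inherits from \<open>w2\<close> the
  \<pi> values of a repetition. Its \<pi>' values after \<open>s\<close> then repeat those at its
  beginning, which belong to \<open>w1\<close>; so \<open>w1\<close> and \<open>w2\<close> agree
  there.\<close>

lemma mixed_strict_border_array:
  assumes len: "length w1 = s + l" "length w2 = s + l" and sl: "l \<le> s"
    and s: "border_at w2 s = 0" and l: "border_at w1 l = border_at w2 l"
    and rep: "\<And>j. j < l \<Longrightarrow> w2 ! (s + j) = w2 ! j"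
    and valid: "valid_strict_border_array
      (take s (strict_border_array w1) @ drop s (strict_border_array w2))"
    and i: "0 < i" "i \<le> l"
  shows "border_at w1 i = border_at w2 i"
proof -
  obtain w :: "nat list" where
    w: "strict_border_array w = take s (strict_border_array w1) @ drop s (strict_border_array w2)"
    using valid unfolding valid_strict_border_array_def by blast
  have lw: "length w = s + l"
    using arg_cong[OF w, of length] len by simp
  have w1: "strict_border_at w t = strict_border_at w1 t" if t: "0 < t" "t \<le> s" for t
  proof -
    obtain q where q: "t = Suc q" using t by (cases t) auto
    have "strict_border_at w (Suc q) = strict_border_array w ! q"
      using t q lw by (simp add: nth_strict_border_array)
    also have "\<dots> = strict_border_array w1 ! q"
      unfolding w using t q len by (simp add: nth_append)
    finally show ?thesis
      using t q len by (simp add: nth_strict_border_array)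
  qed
  have w2: "strict_border_at w t = strict_border_at w2 t" if t: "s < t" "t \<le> s + l" for t
  proof -
    obtain q where q: "t = Suc q" using t by (cases t) auto
    have "strict_border_at w (Suc q) = strict_border_array w ! q"
      using t q lw by (simp add: nth_strict_border_array)
    also have "\<dots> = strict_border_array w2 ! q"
      unfolding w using t q len by (simp add: nth_append)
    finally show ?thesis
      using t q len by (simp add: nth_strict_border_array)
  qed
  have pi2: "border_at w2 (s + t) = int t" if "t \<le> l" for t
    using that len i sl by (intro border_at_repeat s rep) auto
  have pi: "border_at w (s + t) = int t" if "0 < t" "t \<le> l" for t
  proof -
    \<comment> \<open>At the last position \<pi>' equals \<pi>, which starts the descent.\<close>
    have "border_at w (s + l) = border_at w2 (s + l)"
      using w2[of "s + l"] lw len i by (simp add: strict_border_at_def)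
    then have "border_at w (s + t) = border_at w2 (s + t)"
      using that lw len w2 by - (rule border_at_cong_strict[where q = "s + l"], auto)
    with pi2 that show ?thesis by simp
  qed
  \<comment> \<open>Go from \<open>t\<close> to \<open>s + t\<close> inside \<open>w\<close>, change
    to \<open>w2\<close> there, and return to \<open>t\<close>. The case \<open>t = l\<close> is
    excluded, since the copy must extend by one more letter.\<close>
  have "strict_border_at w1 t = strict_border_at w2 t" if t: "0 < t" "t < l" for t
  proof -
    have "strict_border_at w1 t = strict_border_at w t" using w1 t sl by simp
    also have "\<dots> = strict_border_at w (s + t)"
      using t pi[of t] pi[of "Suc t"] lw by (intro strict_border_at_eq[symmetric]) auto
    also have "\<dots> = strict_border_at w2 (s + t)" using w2 t by simp
    also have "\<dots> = strict_border_at w2 t"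
      using t pi2[of t] pi2[of "Suc t"] len by (intro strict_border_at_eq) auto
    finally show ?thesis .
  qed
  then show ?thesis
    using i l len sl by - (rule border_at_cong_strict[where q = l], auto)
qed

section \<open>Words encoding bit strings\<close>

text \<open>A fresh letter is named by its own position. The letter \<open>1\<close> occurs only
  once, so a border \<open>0\<close> can never be extended.\<close>

definition bit_word :: "bool list \<Rightarrow> nat list" where
  "bit_word x = 0 # 1 # map (\<lambda>i. if x ! i then 0 else i + 2) [0..<length x]"

lemma length_bit_word [simp]: "length (bit_word x) = length x + 2"
  by (simp add: bit_word_def)

lemma bit_word_snoc: "bit_word (x @ [b]) = bit_word x @ [if b then 0 else length x + 2]"
  by (simp add: bit_word_def nth_append)

lemma bit_word_nth_0 [simp]: "bit_word x ! 0 = 0"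
  by (simp add: bit_word_def)

lemma bit_word_nth_1 [simp]: "bit_word x ! Suc 0 = 1"
  by (simp add: bit_word_def)

lemma bit_word_nth_add_2: "i < length x \<Longrightarrow> bit_word x ! (i + 2) = (if x ! i then 0 else i + 2)"
  by (simp add: bit_word_def)

lemma set_bit_word: "set (bit_word x) \<subseteq> {..<length x + 2}"
  by (auto simp: bit_word_def)

text \<open>By induction nonempty borders have length 1 and are followed by the letter
  \<open>1\<close>; thus an appended \<open>0\<close> yields 1, and a fresh letter yields 0.\<close>

lemma border_array_bit_word: "border_array (bit_word x) = 0 # 0 # map of_bool x"
proof (induction x rule: rev_induct)
  case Nil
  have "border_array ([] @ [0, 1 :: nat]) = [0, 0]"
    by (subst border_array_append_fresh) (simp_all add: border_array_def)
  then show ?case by (simp add: bit_word_def)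
next
  case (snoc b x)
  let ?w = "bit_word (x @ [b])"
  have "border_at ?w (Suc (length x + 2)) = of_bool b"
  proof (cases b)
    case True
    have "border_at (bit_word x) (length x + 2) = (0 # 0 # map of_bool x) ! (length x + 1)"
      unfolding snoc.IH[symmetric] by (simp add: nth_border_array)
    also have "\<dots> \<le> 1" by (cases x) (auto simp: nth_Cons')
    finally have "border_at ?w (length x + 2) \<le> 1"
      by (simp add: bit_word_snoc border_at_append)
    then have "?w ! r \<noteq> ?w ! 0" if "border_len ?w (length x + 2) r" "0 < r" for r
      using border_at_le_1E[OF that] by simp
    moreover have "?w ! (length x + 2) = 0" using True bit_word_nth_add_2[of "length x" "x @ [b]"]
      by simp
    ultimately show ?thesis using True by (subst border_at_Suc_eq_1) auto
  next
    case False
    have "bit_word x ! j < length x + 2" if "j < length x + 2" for j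
      using that set_bit_word[of x] by (metis length_bit_word lessThan_iff nth_mem subsetD)
    then have "border_at ?w (Suc (length x + 2)) = 0"
      using False by (intro border_at_Suc_fresh) (auto simp: bit_word_snoc nth_append dest: less_imp_neq)
    with False show ?thesis by simp
  qed
  then show ?case
    using snoc border_array_snoc[of "bit_word x" "if b then 0 else length x + 2"]
    by (simp add: bit_word_snoc)
qed

lemma border_at_bit_word_le_1:
  assumes "0 < i" "i \<le> length x + 2"
  shows "border_at (bit_word x) i \<le> 1"
proof -
  have "border_at (bit_word x) i = (0 # 0 # map of_bool x) ! (i - 1)"
    unfolding border_array_bit_word[symmetric] using assms by (simp add: nth_border_array)
  also have "\<dots> \<le> 1" using assms by (auto simp: nth_Cons')
  finally show ?thesis .
qed

section \<open>The two fooling sets\<close>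

text \<open>The increasing run describes a copy of the first \<open>i + 2\<close> letters, the
  \<open>1\<close> a following letter that equals the first one without extending the copy. The
  zeros only pad.\<close>

definition bit_query :: "nat \<Rightarrow> nat \<Rightarrow> int list" where
  "bit_query i e = map int [0..<i + 3] @ 1 # replicate e 0"

text \<open>If \<open>x ! i\<close> holds, the letter after the copied prefix equals the first
  letter, so the final letter demanded would extend the copy. Otherwise the letter \<open>0\<close>
  realizes the query.\<close>

lemma valid_bit_query:
  assumes "i < length x"
  shows "valid_border_array (border_array (bit_word x) @ bit_query i e) \<longleftrightarrow> \<not> x ! i"
proof
  assume nx: "\<not> x ! i"
  let ?k = "length x + 2"
  let ?u = "bit_word x @ ?k # take (i + 2) (bit_word x)"
  have "border_array ?u = border_array (bit_word x) @ map int [0..<Suc (i + 2)]"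
    using set_bit_word[of x] assms by (intro border_array_append_copy) auto
  then have u: "border_array ?u = border_array (bit_word x) @ map int [0..<i + 3]"
    by (simp add: numeral_eq_Suc)
  have len: "length ?u = ?k + (i + 3)" using assms by simp
  have "border_at ?u (length ?u) = border_array ?u ! (?k + (i + 2))"
    using assms by (simp add: nth_border_array)
  also have "\<dots> = int (i + 2)" unfolding u by (simp add: nth_append del: upt_Suc)
  finally have at: "border_at ?u (length ?u) = int (i + 2)" .
  have blen: "border_len ?u (length ?u) (i + 2)"
    by (rule border_len_border_at[OF _ _ at]) simp_all
  \<comment> \<open>A nonempty border has length \<open>i + 2\<close> or 1, and the letter after it
    is \<open>i + 2\<close> or \<open>1\<close> respectively.\<close>
  have "?u ! r \<noteq> 0" if r: "border_len ?u (length ?u) r" "0 < r" for r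
  proof -
    have "int r \<le> int (i + 2)" using border_len_le_border_at[OF _ r(1)] at by simp
    then consider "r = i + 2" | "r < i + 2" by linarith
    then show ?thesis
    proof cases
      case 1
      then show ?thesis using nx assms bit_word_nth_add_2[of i x] by (simp add: nth_append)
    next
      case 2
      then have "border_len ?u (i + 2) r" using border_len_shorter[OF blen] r by simp
      moreover have "border_at ?u (i + 2) \<le> 1"
        using border_at_bit_word_le_1[of "i + 2" x] assms by (simp add: border_at_append)
      ultimately have "r = 1" using border_at_le_1E[of ?u "i + 2" r] r assms by simp
      then show ?thesis by (simp add: nth_append)
    qed
  qed
  then have no: "(?u @ [0]) ! r \<noteq> (?u @ [0]) ! 0"
    if "border_len (?u @ [0]) (length ?u) r" "0 < r" for r
  proof -
    note ne = \<open>\<And>r. border_len ?u (length ?u) r \<Longrightarrow> 0 < r \<Longrightarrow> ?u ! r \<noteq> 0\<close>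
    have "border_len ?u (length ?u) r" using that(1) border_len_append by blast
    moreover from this have "r < length ?u" by (rule border_len_less)
    then have "(?u @ [0]) ! r = ?u ! r" by (rule nth_append_left)
    moreover have "(?u @ [0]) ! 0 = 0" by (simp add: nth_append)
    ultimately show ?thesis using that(2) ne by metis
  qed
  have "border_at (?u @ [0]) (Suc (length ?u)) = 1"
    by (rule border_at_Suc_eq_1[OF _ _ _ no]) (auto simp: nth_append)
  then have u0: "border_array (?u @ [0]) = border_array (bit_word x) @ map int [0..<i + 3] @ [1]"
    using border_array_snoc[of ?u 0] u by simp
  have sub: "set (?u @ [0]) \<subseteq> {..<?k + 1}"
    using set_bit_word[of x] set_take_subset[of "i + 2" "bit_word x"] by fastforce
  have "border_array ((?u @ [0]) @ [?k + 1..<?k + 1 + e]) = border_array (?u @ [0]) @ replicate e 0"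
    using border_array_append_fresh[of "[?k + 1..<?k + 1 + e]" "?u @ [0]"] sub by fastforce
  then show "valid_border_array (border_array (bit_word x) @ bit_query i e)"
    unfolding u0 bit_query_def valid_border_array_def by auto
next
  assume "valid_border_array (border_array (bit_word x) @ bit_query i e)"
  then obtain w :: "nat list" where
    "border_array w = border_array (bit_word x) @ bit_query i e"
    unfolding valid_border_array_def by blast
  then have w: "border_array w = (0 # 0 # map of_bool x) @ map int [0..<i + 3] @ 1 # replicate e 0"
    by (simp add: border_array_bit_word bit_query_def)
  \<comment> \<open>The number of letters before the one whose entry is the \<open>1\<close> of the
    query.\<close>
  define p where "p = length x + i + 5"
  have len: "length w = p + 1 + e" using arg_cong[OF w, of length] by (simp add: p_def)
  have "border_at w p = border_array w ! (length x + 2 + (i + 2))"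
    using len by (simp add: nth_border_array p_def numeral_eq_Suc)
  also have "\<dots> = int (i + 2)" unfolding w by (subst nth_append_right) (simp_all add: nth_append del: upt_Suc)
  finally have "border_len w p (i + 2)" using len p_def by (intro border_len_border_at) auto
  have "border_at w (Suc p) = border_array w ! (length x + 2 + (i + 3))"
    using len by (simp add: nth_border_array p_def)
  also have "\<dots> = 1" unfolding w by (subst nth_append_right) (simp_all add: nth_append del: upt_Suc)
  finally have p1: "border_at w (Suc p) = int (Suc 0)" by simp
  then have "border_len w (Suc p) (Suc 0)" using len by (intro border_len_border_at) auto
  then have "w ! p = w ! 0" by simp
  show "\<not> x ! i"
  proof
    assume "x ! i"
    have "border_at w (Suc (i + 2)) = border_array w ! (i + 2)"
      using len assms by (simp add: nth_border_array p_def)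
    also have "\<dots> = int (Suc 0)" unfolding w using assms \<open>x ! i\<close> by (simp add: nth_append)
    finally have "border_len w (Suc (i + 2)) (Suc 0)"
      using len assms p_def by (intro border_len_border_at) auto
    then have "w ! (i + 2) = w ! p" using \<open>w ! p = w ! 0\<close> by simp
    with \<open>border_len w p (i + 2)\<close> have "border_len w (Suc p) (Suc (i + 2))" by simp
    then have "int (Suc (i + 2)) \<le> border_at w (Suc p)"
      using len by (intro border_len_le_border_at) auto
    with p1 show False by simp
  qed
qed

section \<open>Lower bound for border arrays\<close>

lemma requires_linear_memory_border_array: "requires_linear_memory valid_border_array"
proof (rule requires_linear_memoryI)
  fix n k :: nat assume n: "n \<ge> 2 * k + 6"
  let ?f = "\<lambda>x. border_array (bit_word x)"
  have sep: "\<exists>z. length (?f x @ z) = n \<and> length (?f y @ z) = n \<and>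
      valid_border_array (?f x @ z) \<noteq> valid_border_array (?f y @ z)"
    if l: "length x = k" "length y = k" and "x \<noteq> y" for x y
  proof -
    have "\<not> (\<forall>i<length x. x ! i = y ! i)"
    proof
      assume "\<forall>i<length x. x ! i = y ! i"
      then have "x = y" using l by (intro nth_equalityI) simp_all
      with \<open>x \<noteq> y\<close> show False by contradiction
    qed
    then obtain i where i: "i < k" "x ! i \<noteq> y ! i" unfolding l by auto
    \<comment> \<open>Query a bit where \<open>x\<close> and \<open>y\<close> differ;
      \<open>k + 2\<close> prefix entries and \<open>i + 4\<close> query entries precede the
      padding.\<close>
    let ?z = "bit_query i (n - (k + i + 6))"
    have "length (?f x @ ?z) = n" "length (?f y @ ?z) = n"
      using i(1) l n by (simp_all add: bit_query_def)
    moreover have "valid_border_array (?f x @ ?z) \<noteq> valid_border_array (?f y @ ?z)"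
      using i l by (simp only: valid_bit_query) blast
    ultimately show ?thesis by blast
  qed
  have flen: "length (?f x) \<le> n" if "length x = k" for x
    using that n by simp
  show "\<exists>f. \<forall>x y. length x = k \<longrightarrow> length y = k \<longrightarrow>
      length (f x) \<le> n \<and> (x \<noteq> y \<longrightarrow>
        (\<exists>z. length (f x @ z) = n \<and> length (f y @ z) = n \<and>
          valid_border_array (f x @ z) \<noteq> valid_border_array (f (y :: bool list) @ z)))"
    by (rule exI[of _ ?f]) (use sep flen in blast)
qed

section \<open>Lower bound for strict border arrays\<close>

lemma requires_linear_memory_strict_border_array:
  "requires_linear_memory valid_strict_border_array"
proof (rule requires_linear_memoryI)
  fix n k :: nat assume n: "n \<ge> 2 * k + 6"
  \<comment> \<open>The repeated part is the bit word with one fresh letter, so the \<pi> value at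
    \<open>l\<close> is 0 for every bit string, as is the one at \<open>s\<close>.\<close>
  define l where "l = k + 3"
  define s where "s = n - l"
  have ls: "l \<le> s" "n = s + l" using n by (auto simp: l_def s_def)
  define u where "u x = bit_word x @ [k + 2..<s]" for x
  define v where "v x = u x @ take l (u x)" for x
  define f where "f x = take s (strict_border_array (v x))" for x
  have lu: "length (u x) = s" if "length x = k" for x
    using that ls by (simp add: u_def l_def)
  have lv: "length (v x) = s + l" if "length x = k" for x
    using that ls by (simp add: v_def lu)
  have au: "border_array (u x) = 0 # 0 # map of_bool x @ replicate (s - (k + 2)) 0"
    if "length x = k" for x
    using that set_bit_word[of x] unfolding u_def
    by (subst border_array_append_fresh) (auto simp: border_array_bit_word)
  have at: "border_at (v x) (Suc i) = (0 # 0 # map of_bool x @ replicate (s - (k + 2)) 0) ! i"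
    if "length x = k" "i < s" for x i
    using that lu[of x] unfolding au[OF that(1), symmetric]
    by (simp add: nth_border_array v_def border_at_append)
  have zero: "border_at (v x) i = 0" if "length x = k" "k + 2 < i" "i \<le> s" for x i
  proof -
    obtain j where "i = Suc (k + 2 + j)" using \<open>k + 2 < i\<close> less_iff_Suc_add by blast
    then show ?thesis using at[of x "k + 2 + j"] \<open>length x = k\<close> \<open>i \<le> s\<close> by (simp add: nth_append)
  qed
  have sep: "\<exists>z. length (f x @ z) = n \<and> length (f y @ z) = n \<and>
      valid_strict_border_array (f x @ z) \<noteq> valid_strict_border_array (f y @ z)"
    if x: "length x = k" and y: "length y = k" and "x \<noteq> y" for x y
  proof (intro exI conjI)
    \<comment> \<open>This continuation completes the prefix of \<open>y\<close>; validity after the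
      prefix of \<open>x\<close> would force both border arrays to agree up to
      \<open>l\<close>.\<close>
    let ?z = "drop s (strict_border_array (v y))"
    show "length (f x @ ?z) = n" "length (f y @ ?z) = n"
      using x y ls by (simp_all add: f_def lv)
    have "valid_strict_border_array (f y @ ?z)"
      by (simp add: f_def valid_strict_border_array_of_word)
    moreover have "\<not> valid_strict_border_array (f x @ ?z)"
    proof
      assume valid: "valid_strict_border_array (f x @ ?z)"
      have eq: "border_at (v x) i = border_at (v y) i" if "0 < i" "i \<le> l" for i
      proof (rule mixed_strict_border_array[where s = s and l = l])
        show "v y ! (s + j) = v y ! j" if "j < l" for j
          using that ls lu[OF y] by (simp add: v_def nth_append)
        show "border_at (v y) s = 0" "border_at (v x) l = border_at (v y) l"
          using x y ls zero by (simp_all add: l_def)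
      qed (use x y ls lv valid that in \<open>auto simp: f_def\<close>)
      \<comment> \<open>Bit \<open>i\<close> is the \<pi> value at position \<open>i + 3\<close>,
        which lies below \<open>l\<close>.\<close>
      have "x ! i = y ! i" if "i < k" for i
      proof -
        have "i + 2 < s" using that ls by (simp add: l_def)
        then show ?thesis
          using eq[of "Suc (i + 2)"] at[OF x, of "i + 2"] at[OF y, of "i + 2"] that x y
          by (simp add: l_def nth_append of_bool_eq_iff)
      qed
      with x y have "x = y" by (intro nth_equalityI) auto
      with \<open>x \<noteq> y\<close> show False by contradiction
    qed
    ultimately show "valid_strict_border_array (f x @ ?z) \<noteq> valid_strict_border_array (f y @ ?z)"
      by simp
  qed
  have flen: "length (f x) \<le> n" if "length x = k" for x
    using that ls by (simp add: f_def lv)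
  show "\<exists>f. \<forall>x y. length x = k \<longrightarrow> length y = k \<longrightarrow>
      length (f x) \<le> n \<and> (x \<noteq> y \<longrightarrow>
        (\<exists>z. length (f x @ z) = n \<and> length (f y @ z) = n \<and>
          valid_strict_border_array (f x @ z) \<noteq> valid_strict_border_array (f (y :: bool list) @ z)))"
    by (rule exI[of _ f]) (use sep flen in blast)
qed

theorem theorem2:
  shows "requires_linear_memory valid_border_array \<and>
         requires_linear_memory valid_strict_border_array"
  using requires_linear_memory_border_array requires_linear_memory_strict_border_array ..

end
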